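(* Let $\Omega\subset\mathbb{C}$ be a simply connected domain and let $\sigma_0\in\mathbb{N}$. The class $U^{(\zeta_0)}_{mult}(\{n\}_{n\in\mathbb{N}},\{n^2\}_{n\in\mathbb{N}},\ldots,\{n^{\sigma_0}\}_{n\in\mathbb{N}})$ is independent of the choice of $\zeta_0\in\Omega$; that is, for all $\zeta_0,\zeta\in\Omega$, $$U^{(\zeta_0)}_{mult}(\{n\}_{n\in\mathbb{N}},\{n^2\}_{n\in\mathbb{N}},\ldots,\{n^{\sigma_0}\}_{n\in\mathbb{N}})=U^{(\zeta)}_{mult}(\{n\}_{n\in\mathbb{N}},\{n^2\}_{n\in\mathbb{N}},\ldots,\{n^{\sigma_0}\}_{n\in\mathbb{N}}).$$
   Context: Natural numbers are positive integers. $H(\Omega)$ is the space of holomorphic functions on $\Omega$ with the topology of uniform convergence on compact subsets. For a compact set $K\subset\mathbb{C}$, $A(K)$ is the space of functions continuous on $K$ and holomorphic in the interior $K^o$, with the norm $\|g\|_K=\sup_{z\in K}|g(z)|$. $\mathcal{M}_\Omega$ is the set of all compact sets $K\subset\mathbb{C}\setminus\Omega$ with connected complement $K^c=\mathbb{C}\setminus K$. For $f\in H(\Omega)$, $\zeta_0\in\Omega$ and $N\in\mathbb{N}$, $T^{(\zeta_0)}_N(f)(z)=\sum_{k=0}^{N}\frac{f^{(k)}(\zeta_0)}{k!}(z-\zeta_0)^k$ is the $N$-th partial sum of the Taylor expansion of $f$ at $\zeta_0$ (a polynomial, viewed by restriction as an element of $A(K)$). For sequences of natural numbers $\{\lambda^{(\sigma)}_n\}_{n\in\mathbb{N}}$,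 $\sigma=1,\ldots,\sigma_0$, and $\zeta_0\in\Omega$, the class $U^{(\zeta_0)}_{mult}(\{\lambda^{(1)}_n\}_{n\in\mathbb{N}},\ldots,\{\lambda^{(\sigma_0)}_n\}_{n\in\mathbb{N}})$ is the set of all $f\in H(\Omega)$ such that for every choice of compact sets $K_1,\ldots,K_{\sigma_0}\in\mathcal{M}_\Omega$ the set $\{(T^{(\zeta_0)}_{\lambda^{(1)}_n}(f),\ldots,T^{(\zeta_0)}_{\lambda^{(\sigma_0)}_n}(f)):n\in\mathbb{N}\}$ is dense in $A(K_1)\times\cdots\times A(K_{\sigma_0})$ (product topology). *)

theory Defs
  imports "HOL-Analysis.Analysis"
begin

text \<open>
  The normed space \<open>A(K)\<close>, as a metric subspace of the bounded continuous functions on \<open>K\<close>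
  with the supremum metric. Its points are functions on \<open>K\<close> in the sense of
  \<^const>\<open>extensional\<close>, so equality of points is equality on \<open>K\<close>.
\<close>

definition disc_algebra :: "complex set \<Rightarrow> (complex \<Rightarrow> complex) metric" where
  "disc_algebra K =
     submetric (cfunspace (top_of_set K) euclidean_metric) {g. g holomorphic_on interior K}"

lemma mspace_disc_algebra:
  assumes "compact K"
  shows "mspace (disc_algebra K) =
    {g \<in> extensional K. continuous_on K g \<and> g holomorphic_on interior K}"
proof -
  have "bounded (g ` K)" if "continuous_on K g" for g :: "complex \<Rightarrow> complex"
    using assms that compact_continuous_image compact_imp_bounded by blast
  then show ?thesis
    by (auto simp: disc_algebra_def mtopology_of_def)
qed

lemma mdist_disc_algebra:
  assumes "compact K" and "K \<noteq> {}"
    and "g \<in> mspace (disc_algebra K)" and "h \<in> mspace (disc_algebra K)"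
  shows "mdist (disc_algebra K) g h = (SUP z\<in>K. norm (g z - h z))"
proof -
  have "g \<in> Met_TC.fspace K" "h \<in> Met_TC.fspace K"
    using assms(3,4) cfunspace_subset_funspace[of "top_of_set K" "euclidean_metric :: complex metric"]
    unfolding disc_algebra_def by auto
  then show ?thesis
    using assms(2)
    by (simp add: disc_algebra_def mdist_cfunspace_eq_mdist_funspace Met_TC.fdist_def dist_norm)
qed

definition compacts_off :: "complex set \<Rightarrow> complex set set" where
  "compacts_off \<Omega> = {K. compact K \<and> K \<subseteq> - \<Omega> \<and> connected (- K)}"

definition taylor_sum :: "complex \<Rightarrow> nat \<Rightarrow> (complex \<Rightarrow> complex) \<Rightarrow> complex \<Rightarrow> complex" where
  "taylor_sum \<zeta>\<^sub>0 N f z = (\<Sum>k=0..N. (deriv ^^ k) f \<zeta>\<^sub>0 / fact k * (z - \<zeta>\<^sub>0) ^ k)"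

text \<open>
  \<open>U_mult \<Omega> \<zeta>\<^sub>0 \<sigma>\<^sub>0 \<mu>\<close> is the class for the \<open>\<sigma>\<^sub>0\<close> sequences
  \<open>\<mu> \<sigma> = (\<mu> \<sigma> 1, \<mu> \<sigma> 2, \<dots>)\<close>, \<open>\<sigma> = 1, \<dots>, \<sigma>\<^sub>0\<close>; only the indices
  \<open>n \<ge> 1\<close> are used. An element of \<open>H(\<Omega>)\<close> is represented by any total function
  holomorphic on \<open>\<Omega>\<close>; for open \<open>\<Omega>\<close> and \<open>\<zeta>\<^sub>0 \<in> \<Omega>\<close>, membership in the class depends
  only on the values on \<open>\<Omega>\<close>.
\<close>

definition U_mult ::
    "complex set \<Rightarrow> complex \<Rightarrow> nat \<Rightarrow> (nat \<Rightarrow> nat \<Rightarrow> nat) \<Rightarrow> (complex \<Rightarrow> complex) set" where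
  "U_mult \<Omega> \<zeta>\<^sub>0 \<sigma>\<^sub>0 \<mu> =
     {f. f holomorphic_on \<Omega> \<and>
         (\<forall>K \<in> {1..\<sigma>\<^sub>0} \<rightarrow> compacts_off \<Omega>.
            let X = product_topology (\<lambda>\<sigma>. mtopology_of (disc_algebra (K \<sigma>))) {1..\<sigma>\<^sub>0}
            in X closure_of
                 {\<lambda>\<sigma>\<in>{1..\<sigma>\<^sub>0}. restrict (taylor_sum \<zeta>\<^sub>0 (\<mu> \<sigma> n) f) (K \<sigma>) | n. n \<ge> 1}
               = topspace X)}"

end

theory Submission
  imports Defs "HOL-Complex_Analysis.Complex_Analysis"
begin

text \<open>
  Since \<open>\<Omega>\<close> is connected, it suffices that the class does not change under a small move of the
  centre, from \<open>\<zeta>\<^sub>0\<close> to a point \<open>\<zeta>\<close> whose distance from \<open>\<zeta>\<^sub>0\<close> is small compared with the distance of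
  \<open>\<zeta>\<^sub>0\<close> from the boundary (\<open>U_mult_nearby_center\<close>).

  Let \<open>f\<close> be in the class for \<open>\<zeta>\<^sub>0\<close>, let compact sets \<open>K \<sigma>\<close> and targets be given. By universality itself
  the targets may be taken to be polynomials, and these can be approximated on larger compact sets
  \<open>K' \<sigma>\<close> as well. Because \<open>\<Omega>\<close> is simply connected, \<open>K' \<sigma>\<close> can be chosen to meet all circles
  around \<open>\<zeta>\<close> with radius in an interval as long as desired (\<open>compacts_off_enlarge\<close>). A polynomial
  of degree \<open>N\<close> that is bounded on such a set grows only like \<open>\<kappa> ^ N\<close>, with an absolute constant
  \<open>\<kappa>\<close>, on a disc as large as desired (\<open>poly_bound_from_circles\<close>). By Cauchy's inequality, its Taylor
  coefficients at \<open>\<zeta>\<close> of order between \<open>m\<close> and \<open>N\<close> are then negligible, as long as \<open>m\<close> is at least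
  a fixed fraction of \<open>N\<close>: this is the phenomenon of Ostrowski gaps. If on the other hand \<open>m\<close> is at
  most a sufficiently small fraction of \<open>N\<close>, the terms of the series at \<open>\<zeta>\<^sub>0\<close> beyond \<open>N\<close> do not
  contribute to the partial sum of order \<open>m\<close> at \<open>\<zeta>\<close> either. Hence the partial sum of order \<open>N\<close> at
  \<open>\<zeta>\<^sub>0\<close> and the partial sum of order \<open>m\<close> at \<open>\<zeta>\<close> nearly agree on \<open>K \<sigma>\<close>
  (\<open>taylor_sum_change_center\<close>).

  With \<open>N = n ^ \<sigma>\<close> and \<open>m = (n div c) ^ \<sigma>\<close> for a large constant \<open>c\<close>, both requirements on \<open>m\<close> hold for
  all \<open>\<sigma>\<close> simultaneously. So the index \<open>n div c\<close> does at \<open>\<zeta>\<close> what \<open>n\<close> does at \<open>\<zeta>\<^sub>0\<close>.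
\<close>

section \<open>Universality as simultaneous approximation\<close>

text \<open>
  The strict bound on the supremum needs compactness twice: it makes the supremum finite, and it
  makes it a maximum, so that strict pointwise bounds survive. For \<open>K = {}\<close> the supremum of
  the empty set is meaningless, but then \<open>A(K)\<close> has only one point.
\<close>

lemma mdist_disc_algebra_less:
  fixes g h :: "complex \<Rightarrow> complex"
  assumes K: "compact K" and "g \<in> mspace (disc_algebra K)" "h \<in> mspace (disc_algebra K)"
  shows mdist_disc_algebra_lessD:
      "mdist (disc_algebra K) g h < \<epsilon> \<Longrightarrow> z \<in> K \<Longrightarrow> norm (g z - h z) < \<epsilon>"
    and mdist_disc_algebra_lessI:
      "\<epsilon> > 0 \<Longrightarrow> (\<And>z. z \<in> K \<Longrightarrow> norm (g z - h z) < \<epsilon>) \<Longrightarrow> mdist (disc_algebra K) g h < \<epsilon>"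
proof -
  have cont: "continuous_on K (\<lambda>z. norm (g z - h z))"
    using assms by (auto simp: mspace_disc_algebra intro!: continuous_intros)
  show "norm (g z - h z) < \<epsilon>" if "mdist (disc_algebra K) g h < \<epsilon>" "z \<in> K"
  proof -
    have "bdd_above ((\<lambda>z. norm (g z - h z)) ` K)"
      by (intro bounded_imp_bdd_above compact_imp_bounded compact_continuous_image cont K)
    then have "norm (g z - h z) \<le> (SUP z\<in>K. norm (g z - h z))"
      using that by (intro cSUP_upper) auto
    also have "\<dots> = mdist (disc_algebra K) g h"
      using that by (intro mdist_disc_algebra[symmetric] assms) auto
    finally show ?thesis using that by simp
  qed
  show "mdist (disc_algebra K) g h < \<epsilon>"
    if "\<epsilon> > 0" and *: "\<And>z. z \<in> K \<Longrightarrow> norm (g z - h z) < \<epsilon>"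
  proof (cases "K = {}")
    case True
    then have "g = h" using assms by (auto simp: mspace_disc_algebra)
    then show ?thesis using Metric_space.mdist_zero[OF Metric_space_mspace_mdist assms(3)] \<open>\<epsilon> > 0\<close> by simp
  next
    case False
    obtain w where w: "w \<in> K" "\<forall>z\<in>K. norm (g z - h z) \<le> norm (g w - h w)"
      using continuous_attains_sup[OF K False cont] by blast
    have "(SUP z\<in>K. norm (g z - h z)) \<le> norm (g w - h w)"
      using w False by (intro cSUP_least) auto
    then show ?thesis
      using mdist_disc_algebra[OF K False assms(2,3)] *[OF w(1)] by linarith
  qed
qed

lemma holomorphic_on_taylor_sum [holomorphic_intros]: "taylor_sum \<zeta> N f holomorphic_on S"
  unfolding taylor_sum_def by (intro holomorphic_intros)

lemma restrict_in_disc_algebra: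
  assumes "compact K" "continuous_on K g" "g holomorphic_on interior K"
  shows "restrict g K \<in> mspace (disc_algebra K)"
proof -
  have "restrict g K holomorphic_on interior K"
    using assms(3) by (rule holomorphic_transform) (use interior_subset in auto)
  moreover have "continuous_on K (restrict g K)"
    using assms(2) by (simp cong: continuous_on_cong_simp)
  ultimately show ?thesis
    using assms(1) by (auto simp: mspace_disc_algebra)
qed

text \<open>
  Density unwound: basic neighbourhoods in the finite product are boxes of balls, and the smallest
  of the finitely many radii serves all factors at once. The targets \<open>g \<sigma>\<close> are arbitrary total
  functions here, so that restriction to \<open>K \<sigma>\<close> never has to be mentioned again.
\<close>

lemma U_mult_iff:
  "f \<in> U_mult \<Omega> \<zeta> \<sigma>\<^sub>0 \<mu> \<longleftrightarrow> f holomorphic_on \<Omega> \<and>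
     (\<forall>K g \<epsilon>. K \<in> {1..\<sigma>\<^sub>0} \<rightarrow> compacts_off \<Omega> \<longrightarrow>
        (\<forall>\<sigma>\<in>{1..\<sigma>\<^sub>0}. continuous_on (K \<sigma>) (g \<sigma>) \<and> g \<sigma> holomorphic_on interior (K \<sigma>)) \<longrightarrow>
        \<epsilon> > 0 \<longrightarrow>
        (\<exists>n\<ge>1. \<forall>\<sigma>\<in>{1..\<sigma>\<^sub>0}. \<forall>z\<in>K \<sigma>. norm (taylor_sum \<zeta> (\<mu> \<sigma> n) f z - g \<sigma> z) < \<epsilon>))"
proof -
  let ?I = "{1..\<sigma>\<^sub>0}"
  let ?approx = "\<lambda>K g \<epsilon> n. \<forall>\<sigma>\<in>?I. \<forall>z\<in>K \<sigma>. norm (taylor_sum \<zeta> (\<mu> \<sigma> n) f z - g \<sigma> z) < \<epsilon>"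
  define X where "X = (\<lambda>K. product_topology (\<lambda>\<sigma>. mtopology_of (disc_algebra (K \<sigma>))) ?I)"
  define T where "T = (\<lambda>K n. \<lambda>\<sigma>\<in>?I. restrict (taylor_sum \<zeta> (\<mu> \<sigma> n) f) (K \<sigma>))"
  have topX: "topspace (X K) = (\<Pi>\<^sub>E \<sigma>\<in>?I. mspace (disc_algebra (K \<sigma>)))" for K
    by (simp add: X_def)
  have "X K closure_of {T K n | n. n \<ge> 1} = topspace (X K) \<longleftrightarrow>
      (\<forall>g \<epsilon>. (\<forall>\<sigma>\<in>?I. continuous_on (K \<sigma>) (g \<sigma>) \<and> g \<sigma> holomorphic_on interior (K \<sigma>)) \<longrightarrow>
        \<epsilon> > 0 \<longrightarrow> (\<exists>n\<ge>1. ?approx K g \<epsilon> n))" (is "?L \<longleftrightarrow> ?R")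
    if K: "K \<in> ?I \<rightarrow> compacts_off \<Omega>" for K
  proof -
    have cK: "compact (K \<sigma>)" if "\<sigma> \<in> ?I" for \<sigma>
      using K that by (auto simp: compacts_off_def)
    have TK: "restrict (taylor_sum \<zeta> (\<mu> \<sigma> n) f) (K \<sigma>) \<in> mspace (disc_algebra (K \<sigma>))"
      if "\<sigma> \<in> ?I" for \<sigma> n
      by (intro restrict_in_disc_algebra cK that holomorphic_on_imp_continuous_on holomorphic_intros)
    show ?thesis
    proof
      assume L: ?L
      show ?R
      proof (intro allI impI)
        fix g and \<epsilon> :: real
        assume g: "\<forall>\<sigma>\<in>?I. continuous_on (K \<sigma>) (g \<sigma>) \<and> g \<sigma> holomorphic_on interior (K \<sigma>)"
          and "\<epsilon> > 0"
        define x where "x = (\<lambda>\<sigma>\<in>?I. restrict (g \<sigma>) (K \<sigma>))"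
        define B where "B = (\<lambda>\<sigma>. Metric_space.mball (mspace (disc_algebra (K \<sigma>))) (mdist (disc_algebra (K \<sigma>))) (x \<sigma>) \<epsilon>)"
        have x: "x \<sigma> \<in> mspace (disc_algebra (K \<sigma>))" if "\<sigma> \<in> ?I" for \<sigma>
          using that g by (auto simp: x_def intro!: restrict_in_disc_algebra cK)
        have "x \<in> topspace (X K)"
          unfolding topX using x by (auto simp: x_def PiE_def extensional_def)
        then have cl: "x \<in> X K closure_of {T K n | n. n \<ge> 1}" using L by simp
        have op: "openin (X K) (Pi\<^sub>E ?I B)"
          unfolding X_def B_def
          by (intro openin_product_topology_alt[THEN iffD2] ballI exI conjI)
            (auto simp: mtopology_of_def Metric_space.openin_mball)
        have "x \<in> Pi\<^sub>E ?I B"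
        proof (rule PiE_I)
          show "x \<sigma> \<in> B \<sigma>" if "\<sigma> \<in> ?I" for \<sigma>
            unfolding B_def using x[OF that] \<open>\<epsilon> > 0\<close>
            by (simp add: Metric_space.centre_in_mball_iff)
        qed (auto simp: x_def)
        then obtain n where n: "n \<ge> 1" "T K n \<in> Pi\<^sub>E ?I B"
          using cl op unfolding in_closure_of by blast
        have "norm (taylor_sum \<zeta> (\<mu> \<sigma> n) f z - g \<sigma> z) < \<epsilon>" if \<sigma>: "\<sigma> \<in> ?I" and z: "z \<in> K \<sigma>" for \<sigma> z
        proof -
          have "T K n \<sigma> \<in> B \<sigma>" using n(2) \<sigma> by blast
          then have "mdist (disc_algebra (K \<sigma>)) (x \<sigma>) (T K n \<sigma>) < \<epsilon>"
            by (simp add: B_def Metric_space.in_mball)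
          moreover have "T K n \<sigma> \<in> mspace (disc_algebra (K \<sigma>))"
            using TK[OF \<sigma>] \<sigma> by (simp add: T_def)
          ultimately have "norm (x \<sigma> z - T K n \<sigma> z) < \<epsilon>"
            using mdist_disc_algebra_lessD[OF cK[OF \<sigma>] x[OF \<sigma>] _ _ z] by blast
          then show ?thesis using \<sigma> z by (simp add: x_def T_def norm_minus_commute)
        qed
        with n(1) show "\<exists>n\<ge>1. ?approx K g \<epsilon> n" by (intro exI[of _ n] conjI ballI)
      qed
    next
      assume R: ?R
      show ?L
      proof (rule antisym[OF closure_of_subset_topspace], rule subsetI)
        fix x assume x: "x \<in> topspace (X K)"
        show "x \<in> X K closure_of {T K n | n. n \<ge> 1}"
          unfolding in_closure_of
        proof (intro conjI x allI impI, elim conjE)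
          fix V assume "x \<in> V" "openin (X K) V"
          then have "\<exists>U. finite {\<sigma>\<in>?I. U \<sigma> \<noteq> topspace (mtopology_of (disc_algebra (K \<sigma>)))} \<and>
              (\<forall>\<sigma>\<in>?I. openin (mtopology_of (disc_algebra (K \<sigma>))) (U \<sigma>)) \<and>
              x \<in> Pi\<^sub>E ?I U \<and> Pi\<^sub>E ?I U \<subseteq> V"
            unfolding X_def openin_product_topology_alt by (rule bspec[rotated])
          then obtain U where U: "\<forall>\<sigma>\<in>?I. openin (mtopology_of (disc_algebra (K \<sigma>))) (U \<sigma>)"
            "x \<in> Pi\<^sub>E ?I U" "Pi\<^sub>E ?I U \<subseteq> V"
            by blast
          have "\<exists>\<epsilon>>0. \<forall>h\<in>mspace (disc_algebra (K \<sigma>)). mdist (disc_algebra (K \<sigma>)) (x \<sigma>) h < \<epsilon> \<longrightarrow> h \<in> U \<sigma>"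
            if "\<sigma> \<in> ?I" for \<sigma>
          proof -
            have "openin (mtopology_of (disc_algebra (K \<sigma>))) (U \<sigma>)" "x \<sigma> \<in> U \<sigma>" using U that by auto
            then show ?thesis
              unfolding mtopology_of_def
                Metric_space.openin_mtopology[OF Metric_space_mspace_mdist]
              by (meson Metric_space.in_mball Metric_space_mspace_mdist subset_eq)
          qed
          then obtain e where e: "\<And>\<sigma>. \<sigma> \<in> ?I \<Longrightarrow> e \<sigma> > (0::real)"
            "\<And>\<sigma> h. \<sigma> \<in> ?I \<Longrightarrow> h\<in>mspace (disc_algebra (K \<sigma>)) \<Longrightarrow>
               mdist (disc_algebra (K \<sigma>)) (x \<sigma>) h < e \<sigma> \<Longrightarrow> h \<in> U \<sigma>"
            by metis
          define \<epsilon> where "\<epsilon> = Min (insert 1 (e ` ?I))"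
          have \<epsilon>: "\<epsilon> > 0" "\<And>\<sigma>. \<sigma> \<in> ?I \<Longrightarrow> \<epsilon> \<le> e \<sigma>"
            unfolding \<epsilon>_def using e(1) by (auto, auto intro: min.coboundedI2)
          have xm: "x \<sigma> \<in> mspace (disc_algebra (K \<sigma>))" if "\<sigma> \<in> ?I" for \<sigma>
            using x that unfolding topX by blast
          have "\<forall>\<sigma>\<in>?I. continuous_on (K \<sigma>) (x \<sigma>) \<and> x \<sigma> holomorphic_on interior (K \<sigma>)"
            using xm cK mspace_disc_algebra by blast
          then obtain n where n: "n \<ge> 1" "?approx K x \<epsilon> n"
            using R \<epsilon>(1) by blast
          have "T K n \<in> Pi\<^sub>E ?I U"
          proof (rule PiE_I)
            fix \<sigma> assume \<sigma>: "\<sigma> \<in> ?I"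
            have "mdist (disc_algebra (K \<sigma>)) (x \<sigma>) (T K n \<sigma>) < \<epsilon>"
            proof (rule mdist_disc_algebra_lessI[OF cK[OF \<sigma>] xm[OF \<sigma>] _ \<epsilon>(1)])
              show "T K n \<sigma> \<in> mspace (disc_algebra (K \<sigma>))" using TK \<sigma> by (simp add: T_def)
              show "norm (x \<sigma> z - T K n \<sigma> z) < \<epsilon>" if "z \<in> K \<sigma>" for z
                using n(2) \<sigma> that by (simp add: T_def norm_minus_commute)
            qed
            then show "T K n \<sigma> \<in> U \<sigma>"
              using e(2)[OF \<sigma>] \<epsilon>(2)[OF \<sigma>] TK \<sigma> by (force simp: T_def)
          qed (auto simp: T_def)
          then show "\<exists>y. y \<in> {T K n | n. n \<ge> 1} \<and> y \<in> V"
            using U(3) n(1) by blast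
        qed
      qed
    qed
  qed
  then show ?thesis
    unfolding U_mult_def Let_def X_def T_def mem_Collect_eq Ball_def by blast
qed

lemma U_mult_approx:
  assumes "f \<in> U_mult \<Omega> \<zeta> \<sigma>\<^sub>0 \<mu>" "K \<in> {1..\<sigma>\<^sub>0} \<rightarrow> compacts_off \<Omega>"
    and "\<And>\<sigma>. \<sigma> \<in> {1..\<sigma>\<^sub>0} \<Longrightarrow> continuous_on (K \<sigma>) (g \<sigma>) \<and> g \<sigma> holomorphic_on interior (K \<sigma>)"
    and "\<epsilon> > 0"
  shows "\<exists>n\<ge>1. \<forall>\<sigma>\<in>{1..\<sigma>\<^sub>0}. \<forall>z\<in>K \<sigma>. norm (taylor_sum \<zeta> (\<mu> \<sigma> n) f z - g \<sigma> z) < \<epsilon>"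
  by (rule assms(1)[unfolded U_mult_iff, THEN conjunct2, rule_format])
    (use assms in auto)

text \<open>
  The approximating index can be taken beyond any \<open>n\<^sub>0\<close>. The targets are shifted by a small constant
  \<open>t\<close> that, at one point \<open>z\<^sub>0\<close>, none of the errors of the indices below \<open>n\<^sub>0\<close> attains. These indices
  then stay a fixed distance away from the shifted target at \<open>z\<^sub>0\<close> and cannot be the ones that
  approximate it.
\<close>

lemma U_mult_infinitely_often:
  assumes f: "f \<in> U_mult \<Omega> \<zeta> \<sigma>\<^sub>0 \<mu>" and K: "K \<in> {1..\<sigma>\<^sub>0} \<rightarrow> compacts_off \<Omega>"
    and g: "\<And>\<sigma>. \<sigma> \<in> {1..\<sigma>\<^sub>0} \<Longrightarrow> continuous_on (K \<sigma>) (g \<sigma>) \<and> g \<sigma> holomorphic_on interior (K \<sigma>)"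
    and \<epsilon>: "\<epsilon> > 0" and \<tau>: "\<tau> \<in> {1..\<sigma>\<^sub>0}" and z\<^sub>0: "z\<^sub>0 \<in> K \<tau>"
  obtains n where "n \<ge> n\<^sub>0"
    "\<And>\<sigma> z. \<sigma> \<in> {1..\<sigma>\<^sub>0} \<Longrightarrow> z \<in> K \<sigma> \<Longrightarrow> norm (taylor_sum \<zeta> (\<mu> \<sigma> n) f z - g \<sigma> z) < \<epsilon>"
proof -
  define F where "F = (\<lambda>n. taylor_sum \<zeta> (\<mu> \<tau> n) f z\<^sub>0 - g \<tau> z\<^sub>0) ` {..<n\<^sub>0}"
  have "infinite (ball (0::complex) (\<epsilon> / 2))"
    using \<epsilon> uncountable_ball[of "\<epsilon>/2" "0::complex"] countable_finite by fastforce
  then have "infinite (ball 0 (\<epsilon> / 2) - F)" unfolding F_def by (intro Diff_infinite_finite) auto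
  from infinite_imp_nonempty[OF this] obtain t where t: "t \<in> ball 0 (\<epsilon> / 2)" "t \<notin> F" by blast
  obtain d where d: "d > 0" "\<forall>x\<in>F. x \<noteq> t \<longrightarrow> d \<le> dist t x"
    using finite_set_avoid[of F t] by (auto simp: F_def)
  have cont: "continuous_on (K \<sigma>) (\<lambda>z. g \<sigma> z + t) \<and> (\<lambda>z. g \<sigma> z + t) holomorphic_on interior (K \<sigma>)"
    if "\<sigma> \<in> {1..\<sigma>\<^sub>0}" for \<sigma>
    using g[OF that] by (intro conjI continuous_on_add holomorphic_on_add) auto
  have "min d (\<epsilon> / 2) > 0" using d \<epsilon> by simp
  from U_mult_approx[OF f K cont this] have "\<exists>n\<ge>1. \<forall>\<sigma>\<in>{1..\<sigma>\<^sub>0}. \<forall>z\<in>K \<sigma>.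
      norm (taylor_sum \<zeta> (\<mu> \<sigma> n) f z - (g \<sigma> z + t)) < min d (\<epsilon> / 2)"
    by blast
  then obtain n where n: "\<And>\<sigma> z. \<sigma> \<in> {1..\<sigma>\<^sub>0} \<Longrightarrow> z \<in> K \<sigma> \<Longrightarrow>
      norm (taylor_sum \<zeta> (\<mu> \<sigma> n) f z - (g \<sigma> z + t)) < min d (\<epsilon> / 2)"
    by blast
  show thesis
  proof (rule that[of n])
    show "n \<ge> n\<^sub>0"
    proof (rule ccontr)
      assume "\<not> n \<ge> n\<^sub>0"
      then have inF: "taylor_sum \<zeta> (\<mu> \<tau> n) f z\<^sub>0 - g \<tau> z\<^sub>0 \<in> F" by (auto simp: F_def)
      then have "d \<le> dist t (taylor_sum \<zeta> (\<mu> \<tau> n) f z\<^sub>0 - g \<tau> z\<^sub>0)" using d(2) t(2) by metis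
      moreover have "norm (taylor_sum \<zeta> (\<mu> \<tau> n) f z\<^sub>0 - g \<tau> z\<^sub>0 - t) < d"
        using n[OF \<tau> z\<^sub>0] by (simp add: algebra_simps)
      ultimately show False by (simp add: dist_norm norm_minus_commute)
    qed
    fix \<sigma> z assume "\<sigma> \<in> {1..\<sigma>\<^sub>0}" "z \<in> K \<sigma>"
    then have "norm (taylor_sum \<zeta> (\<mu> \<sigma> n) f z - (g \<sigma> z + t)) < \<epsilon> / 2" using n by simp
    moreover have "norm t < \<epsilon> / 2" using t by simp
    moreover have "norm (taylor_sum \<zeta> (\<mu> \<sigma> n) f z - g \<sigma> z)
        \<le> norm (taylor_sum \<zeta> (\<mu> \<sigma> n) f z - (g \<sigma> z + t)) + norm t"
      using norm_triangle_ineq[of "taylor_sum \<zeta> (\<mu> \<sigma> n) f z - (g \<sigma> z + t)" t] by simp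
    ultimately show "norm (taylor_sum \<zeta> (\<mu> \<sigma> n) f z - g \<sigma> z) < \<epsilon>" by linarith
  qed
qed

section \<open>Growth of polynomials bounded on many circles\<close>

lemma power_self_le_exp_fact: "real N ^ N \<le> exp (real N) * fact N"
proof -
  have "(\<Sum>k\<in>{N}. inverse (fact k) * real N ^ k) \<le> exp (real N)"
    unfolding exp_def using sum_le_suminf[OF summable_exp, of "{N}" "real N"]
    by (simp add: scaleR_conv_of_real)
  then show ?thesis by (simp add: field_simps)
qed

text \<open>
  The denominators in Lagrange interpolation at equally spaced nodes: the nodes below \<open>j\<close>
  contribute the first factorial, those above \<open>j\<close> the second.
\<close>

lemma prod_dist_from_node:
  assumes "j \<le> N"
  shows "(\<Prod>i\<in>{..N}-{j}. \<bar>real j - real i\<bar>) = fact j * fact (N - j)"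
  using assms
proof (induction N rule: dec_induct)
  case base
  have "(\<Prod>i\<in>{..j}-{j}. \<bar>real j - real i\<bar>) = (\<Prod>i\<in>{0..<j}. of_nat (j - i))"
    by (intro prod.cong) (auto simp: of_nat_diff)
  also have "\<dots> = fact j" by (simp add: fact_prod_rev)
  finally show ?case by simp
next
  case (step N)
  have "{..Suc N} - {j} = insert (Suc N) ({..N} - {j})" using step by auto
  then show ?case using step by (simp add: Suc_diff_le fact_Suc) 
qed

lemma lagrange_interpolation:
  fixes p :: "'a::field poly"
  assumes "degree p \<le> N" and inj: "inj_on z {..N}"
  shows "poly p w = (\<Sum>j\<le>N. poly p (z j) * (\<Prod>i\<in>{..N}-{j}. (w - z i) / (z j - z i)))"
proof -
  define l where "l j = (\<Prod>i\<in>{..N}-{j}. [:- z i, 1:])" for j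
  define q where "q = (\<Sum>j\<le>N. smult (poly p (z j) / (\<Prod>i\<in>{..N}-{j}. z j - z i)) (l j))"
  have q: "poly q w = (\<Sum>j\<le>N. poly p (z j) * (\<Prod>i\<in>{..N}-{j}. (w - z i) / (z j - z i)))" for w
    by (simp add: q_def l_def poly_sum poly_prod prod_dividef)
  have "degree (l j) \<le> N" if "j \<le> N" for j
  proof -
    have "degree (l j) \<le> (\<Sum>i\<in>{..N}-{j}. degree [:- z i, 1:])"
      unfolding l_def by (rule order_trans[OF degree_prod_sum_le]) auto
    also have "\<dots> = N" using that by simp
    finally show ?thesis .
  qed
  then have "degree q \<le> N"
    unfolding q_def by (intro degree_sum_le) (auto intro: order_trans[OF degree_smult_le])
  moreover have "poly p x = poly q x" if x: "x \<in> z ` {..N}" for x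
  proof -
    obtain k where k: "k \<le> N" "x = z k" using x by auto
    have "(\<Prod>i\<in>{..N}-{j}. (x - z i) / (z j - z i)) = (if j = k then 1 else 0)" if "j \<le> N" for j
    proof (cases "j = k")
      case True
      have "(x - z i) / (z j - z i) = 1" if "i \<in> {..N} - {j}" for i
        using that k True inj_onD[OF inj, of k i] by auto
      then have "(\<Prod>i\<in>{..N}-{j}. (x - z i) / (z j - z i)) = 1" by (intro prod.neutral ballI)
      then show ?thesis using True by simp
    next
      case False
      then show ?thesis using k by (auto intro!: prod_zero)
    qed
    then have "poly q x = (\<Sum>j\<le>N. poly p (z j) * (if j = k then 1 else 0))"
      unfolding q by (intro sum.cong) auto
    also have "\<dots> = poly p x" using k by (simp add: if_distrib cong: if_cong)
    finally show ?thesis by simp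
  qed
  moreover have "card (z ` {..N}) = Suc N" using card_image[OF inj] by simp
  ultimately have "p = q" using assms(1) by (intro poly_eqI_degree[of "z ` {..N}"]) auto
  with q show ?thesis by metis
qed

text \<open>
  An elementary substitute for the Bernstein--Walsh inequality. A set that meets all circles around
  \<open>a\<close> of radius between \<open>s\<close> and \<open>s + D\<close> contains \<open>N + 1\<close> nodes whose moduli (seen from \<open>a\<close>) are
  equally spaced with step \<open>D / N\<close>; by the triangle inequality the nodes are at least as far apart
  as their moduli. Lagrange interpolation at these nodes bounds \<open>p\<close> by
  \<open>A * (3 * N) ^ N * (\<Sum>j\<le>N. 1 / (fact j * fact (N - j))) = A * 6 ^ N * N ^ N / fact N\<close>, and
  \<open>N ^ N / fact N \<le> exp N\<close>. The constant \<open>6 * exp 1\<close> depends neither on \<open>D\<close> nor on \<open>N\<close>.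
\<close>

lemma poly_bound_from_circles:
  fixes p :: "complex poly"
  assumes deg: "degree p \<le> N" and D: "0 < D" and s: "0 \<le> s" "s \<le> D"
    and circles: "\<And>t. s \<le> t \<Longrightarrow> t \<le> s + D \<Longrightarrow> \<exists>z\<in>K. norm (z - a) = t"
    and bound: "\<And>z. z \<in> K \<Longrightarrow> norm (poly p z) \<le> A"
    and w: "norm (w - a) \<le> D"
  shows "norm (poly p w) \<le> A * (6 * exp 1) ^ N"
proof -
  define h where "h = D / real N"
  have "\<exists>z\<in>K. norm (z - a) = s + j * h" if "j \<le> N" for j :: nat
  proof (rule circles)
    show "s \<le> s + j * h" using D by (simp add: h_def)
    have "j * h \<le> D" using that D by (cases "N = 0") (auto simp: h_def field_simps)
    then show "s + j * h \<le> s + D" by simp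
  qed
  then obtain z where z: "\<And>j. j \<le> N \<Longrightarrow> z j \<in> K" "\<And>j. j \<le> N \<Longrightarrow> norm (z j - a) = s + j * h"
    by metis
  have sep: "\<bar>real j - real i\<bar> * h \<le> norm (z j - z i)" if "i \<le> N" "j \<le> N" for i j
  proof -
    have "\<bar>norm (z j - a) - norm (z i - a)\<bar> \<le> norm ((z j - a) - (z i - a))"
      by (rule norm_triangle_ineq3)
    moreover have "\<bar>norm (z j - a) - norm (z i - a)\<bar> = \<bar>real j - real i\<bar> * h"
      using that D z by (simp add: h_def abs_mult flip: left_diff_distrib diff_divide_distrib)
    ultimately show ?thesis by simp
  qed
  have far: "norm (w - z i) \<le> 3 * D" if "i \<le> N" for i
  proof -
    have "real i * h \<le> D" using that D by (cases "N = 0") (auto simp: h_def field_simps)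
    then have "norm (z i - a) \<le> 2 * D" using z(2)[OF that] s by simp
    moreover have "norm (w - z i) \<le> norm (w - a) + norm (z i - a)"
      using norm_triangle_ineq4[of "w - a" "z i - a"] by simp
    ultimately show ?thesis using w by linarith
  qed
  have "A \<ge> 0" using bound[OF z(1)[of 0]] norm_ge_zero order_trans by blast
  show ?thesis
  proof (cases "N = 0")
    \<comment> \<open>For \<open>N = 0\<close> the step \<open>h\<close> is the junk value \<open>D / 0 = 0\<close>, but a single node is enough.\<close>
    case True
    then have "poly p w = poly p (z 0)" using deg by (auto elim!: degree_eq_zeroE)
    then show ?thesis using bound[OF z(1)[of 0]] True by simp
  next
    case False
    have hpos: "h > 0" using False D by (simp add: h_def)
    have inj: "inj_on z {..N}"
    proof (rule inj_onI)
      fix i j assume "i \<in> {..N}" "j \<in> {..N}" "z i = z j"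
      then have "\<bar>real j - real i\<bar> * h \<le> 0" using sep[of i j] by simp
      then show "i = j" using hpos by (simp add: mult_le_0_iff)
    qed
    have "norm (poly p w) \<le>
        (\<Sum>j\<le>N. norm (poly p (z j) * (\<Prod>i\<in>{..N}-{j}. (w - z i) / (z j - z i))))"
      unfolding lagrange_interpolation[OF deg inj, of w] by (rule norm_sum)
    also have "\<dots> \<le> (\<Sum>j\<le>N. A * ((3 * D / h) ^ N / (fact j * fact (N - j))))"
    proof (rule sum_mono)
      fix j assume "j \<in> {..N}"
      then have j: "j \<le> N" by simp
      have "norm (\<Prod>i\<in>{..N}-{j}. (w - z i) / (z j - z i))
          \<le> (\<Prod>i\<in>{..N}-{j}. (3 * D / h) / \<bar>real j - real i\<bar>)"
        unfolding prod_norm[symmetric]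
      proof (rule prod_mono, safe)
        fix i assume i: "i \<le> N" "i \<noteq> j"
        have "norm (w - z i) / norm (z j - z i) \<le> 3 * D / (\<bar>real j - real i\<bar> * h)"
          using far[OF i(1)] sep[OF i(1) j] i hpos D by (intro frac_le) auto
        then show "norm ((w - z i) / (z j - z i)) \<le> (3 * D / h) / \<bar>real j - real i\<bar>"
          by (simp add: norm_divide mult.commute)
      qed simp
      also have "\<dots> = (3 * D / h) ^ N / (fact j * fact (N - j))"
        using j by (simp only: prod_dividef prod_dist_from_node prod_constant) (simp add: power_divide)
      finally show "norm (poly p (z j) * (\<Prod>i\<in>{..N}-{j}. (w - z i) / (z j - z i)))
          \<le> A * ((3 * D / h) ^ N / (fact j * fact (N - j)))"
        unfolding norm_mult using bound[OF z(1)[OF j]] \<open>A \<ge> 0\<close> by (intro mult_mono) auto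
    qed
    also have "\<dots> = (\<Sum>j\<le>N. A * (3 * D / h) ^ N / fact N * real (N choose j))"
      by (intro sum.cong) (auto simp: binomial_fact)
    also have "\<dots> = A * (3 * D / h) ^ N / fact N * 2 ^ N"
      unfolding sum_distrib_left[symmetric] of_nat_sum[symmetric] choose_row_sum by simp
    also have "3 * D / h = 3 * real N" using D False by (simp add: h_def)
    also have "A * (3 * real N) ^ N / fact N * 2 ^ N = A * 6 ^ N * (real N ^ N / fact N)"
      by (simp add: power_mult_distrib flip: power_mult_distrib[of 3 2 N])
    also have "\<dots> \<le> A * 6 ^ N * exp (real N)"
      using power_self_le_exp_fact[of N] \<open>A \<ge> 0\<close> 
      by (intro mult_left_mono) (auto simp: divide_le_eq)
    also have "\<dots> = A * (6 * exp 1) ^ N"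
      by (simp add: power_mult_distrib exp_of_nat_mult flip: exp_of_nat_mult)
    finally show ?thesis .
  qed
qed

section \<open>Estimates for Taylor sums\<close>

lemma circle_bound_nonneg:
  fixes g :: "complex \<Rightarrow> complex"
  assumes "\<And>z. norm (z - a) = r \<Longrightarrow> norm (g z) \<le> B" and "r > 0"
  shows "0 \<le> B"
  using order_trans[OF norm_ge_zero assms(1)[of "a + of_real r"]] assms(2) by simp

text \<open>
  The remainder is the tail of the power series. Cauchy's inequality on the circle of radius \<open>D\<close>
  bounds its terms by \<open>B * (R / D) ^ k\<close>, and \<open>R / D \<le> 1 / 2\<close> makes the geometric tail at most twice
  its first term.
\<close>

lemma taylor_remainder_bound:
  assumes holo: "g holomorphic_on ball \<zeta> D" and cont: "continuous_on (cball \<zeta> D) g"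
    and R: "0 \<le> R" "2 * R \<le> D" and D: "0 < D"
    and B: "\<And>z. norm (z - \<zeta>) = D \<Longrightarrow> norm (g z) \<le> B"
    and w: "norm (w - \<zeta>) \<le> R"
  shows "norm (g w - taylor_sum \<zeta> m g w) \<le> 2 * B * (R / D) ^ Suc m"
proof -
  define c where "c k = (deriv ^^ k) g \<zeta> / fact k * (w - \<zeta>) ^ k" for k
  have "w \<in> ball \<zeta> D" using w R D by (simp add: dist_norm norm_minus_commute)
  then have "c sums g w" unfolding c_def by (rule holomorphic_power_series[OF holo])
  then have "(\<lambda>k. c (k + Suc m)) sums (g w - (\<Sum>k<Suc m. c k))"
    by (rule sums_split_initial_segment)
  moreover have "(\<Sum>k<Suc m. c k) = taylor_sum \<zeta> m g w"
    by (simp add: taylor_sum_def c_def atLeast0AtMost lessThan_Suc_atMost)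
  ultimately have tail: "(\<lambda>k. c (k + Suc m)) sums (g w - taylor_sum \<zeta> m g w)" by simp
  have "B \<ge> 0" by (rule circle_bound_nonneg[OF B D])
  have q: "0 \<le> R / D" "R / D \<le> 1 / 2" using R D by auto
  have cb: "norm (c k) \<le> B * (R / D) ^ k" for k
  proof -
    have "norm ((deriv ^^ k) g \<zeta>) \<le> fact k * B / D ^ k"
      by (rule Cauchy_inequality[OF holo cont D]) (use B in \<open>simp add: norm_minus_commute\<close>)
    then have "norm ((deriv ^^ k) g \<zeta> / fact k) \<le> B / D ^ k"
      by (simp add: norm_divide field_simps)
    moreover have "norm ((w - \<zeta>) ^ k) \<le> R ^ k"
      unfolding norm_power using w by (intro power_mono) auto
    ultimately have "norm (c k) \<le> B / D ^ k * R ^ k"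
      unfolding c_def norm_mult using \<open>B \<ge> 0\<close> D by (intro mult_mono) auto
    then show ?thesis by (simp add: power_divide)
  qed
  have "norm (c (k + Suc m)) \<le> B * (R / D) ^ Suc m * (1 / 2) ^ k" for k
  proof -
    have "norm (c (k + Suc m)) \<le> B * ((R / D) ^ Suc m * (R / D) ^ k)"
      using cb[of "k + Suc m"] by (simp only: power_add mult.commute)
    also have "\<dots> \<le> B * ((R / D) ^ Suc m * (1 / 2) ^ k)"
      using q \<open>B \<ge> 0\<close> by (intro mult_left_mono power_mono zero_le_power)
    finally show ?thesis by (simp add: mult.assoc)
  qed
  moreover have "(\<lambda>k. B * (R / D) ^ Suc m * (1 / 2) ^ k) sums (B * (R / D) ^ Suc m * 2)"
    using geometric_sums[of "1/2::real"] by (intro sums_mult) simp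
  ultimately have "norm (\<Sum>k. c (k + Suc m)) \<le> B * (R / D) ^ Suc m * 2"
    by (metis norm_suminf_le sums_summable sums_unique)
  then show ?thesis using sums_unique[OF tail] by (simp add: mult_ac)
qed

text \<open>
  Here the point \<open>w\<close> may lie far outside the disc on which \<open>g\<close> is known, so each power
  \<open>(R / s) ^ k\<close> may be large; what matters is only that the growth is geometric in \<open>m\<close>. The
  factor \<open>2 ^ m\<close> absorbs the number \<open>m + 1\<close> of terms.
\<close>

lemma taylor_sum_bound:
  assumes holo: "g holomorphic_on ball \<zeta> s" and cont: "continuous_on (cball \<zeta> s) g"
    and s: "0 < s" and R: "0 \<le> R"
    and B: "\<And>z. norm (z - \<zeta>) = s \<Longrightarrow> norm (g z) \<le> B"
    and w: "norm (w - \<zeta>) \<le> R"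
  shows "norm (taylor_sum \<zeta> m g w) \<le> B * (2 * max 1 (R / s)) ^ m"
proof -
  have "B \<ge> 0" by (rule circle_bound_nonneg[OF B s])
  have "norm ((deriv ^^ k) g \<zeta> / fact k * (w - \<zeta>) ^ k) \<le> B * max 1 (R / s) ^ m" if "k \<le> m" for k
  proof -
    have "norm ((deriv ^^ k) g \<zeta>) \<le> fact k * B / s ^ k"
      by (rule Cauchy_inequality[OF holo cont s]) (use B in \<open>simp add: norm_minus_commute\<close>)
    then have "norm ((deriv ^^ k) g \<zeta> / fact k) \<le> B / s ^ k"
      by (simp add: norm_divide field_simps)
    moreover have "norm ((w - \<zeta>) ^ k) \<le> R ^ k"
      unfolding norm_power using w by (intro power_mono) auto
    ultimately have "norm ((deriv ^^ k) g \<zeta> / fact k * (w - \<zeta>) ^ k) \<le> B / s ^ k * R ^ k"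
      unfolding norm_mult using \<open>B \<ge> 0\<close> s by (intro mult_mono) auto
    also have "\<dots> = B * (R / s) ^ k" by (simp add: power_divide)
    also have "\<dots> \<le> B * max 1 (R / s) ^ k"
      using \<open>B \<ge> 0\<close> s R by (intro mult_left_mono power_mono) auto
    also have "\<dots> \<le> B * max 1 (R / s) ^ m"
      using \<open>B \<ge> 0\<close> that by (intro mult_left_mono power_increasing) auto
    finally show ?thesis .
  qed
  then have "norm (taylor_sum \<zeta> m g w) \<le> (\<Sum>k=0..m. B * max 1 (R / s) ^ m)"
    unfolding taylor_sum_def by (intro sum_norm_le) auto
  also have "\<dots> = real (Suc m) * (B * max 1 (R / s) ^ m)" by simp
  also have "\<dots> \<le> 2 ^ m * (B * max 1 (R / s) ^ m)"
  proof (intro mult_right_mono)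
    have "Suc m \<le> 2 ^ m" by (induction m) auto
    then show "real (Suc m) \<le> 2 ^ m" by (metis of_nat_le_iff of_nat_numeral of_nat_power)
  qed (use \<open>B \<ge> 0\<close> in auto)
  finally show ?thesis by (simp add: power_mult_distrib mult_ac)
qed

lemma taylor_sum_diff:
  assumes "f holomorphic_on S" "g holomorphic_on S" "open S" "\<zeta> \<in> S"
  shows "taylor_sum \<zeta> m (\<lambda>z. f z - g z) w = taylor_sum \<zeta> m f w - taylor_sum \<zeta> m g w"
  unfolding taylor_sum_def using higher_deriv_diff[OF assms]
  by (simp add: diff_divide_distrib left_diff_distrib sum_subtractf)

lemma taylor_sum_eq_poly:
  obtains p :: "complex poly" where "degree p \<le> N" "\<And>z. poly p z = taylor_sum \<zeta> N f z"
proof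
  let ?p = "\<Sum>k=0..N. smult ((deriv ^^ k) f \<zeta> / fact k) ([:- \<zeta>, 1:] ^ k)"
  show "poly ?p z = taylor_sum \<zeta> N f z" for z
    by (simp add: poly_sum taylor_sum_def)
  have "degree ([:- \<zeta>, 1:] ^ k) \<le> k" for k
    using degree_power_le[of "[:- \<zeta>, 1:]" k] by simp
  then show "degree ?p \<le> N"
    by (intro degree_sum_le) (auto intro!: order_trans[OF degree_smult_le] intro: order_trans)
qed

section \<open>Enlarging compact sets off a simply connected domain\<close>

text \<open>
  Otherwise the whole circle would lie in \<open>\<Omega>\<close> and wind once around the point \<open>b\<close> that \<open>\<Omega>\<close> omits.
\<close>

lemma simply_connected_complement_meets_circle:
  fixes \<Omega> :: "complex set"
  assumes "simply_connected \<Omega>" and "b \<notin> \<Omega>" and t: "norm (b - a) < t"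
  shows "\<exists>z. z \<notin> \<Omega> \<and> norm (z - a) = t"
proof (rule ccontr)
  assume "\<not> ?thesis"
  then have sub: "path_image (circlepath a t) \<subseteq> \<Omega>"
    using t norm_ge_zero[of "b - a"]
    by (auto simp: path_image_circlepath dist_norm norm_minus_commute abs_if simp del: norm_ge_zero)
  have "winding_number (circlepath a t) b = 0"
    by (rule simply_connected_imp_winding_number_zero[OF assms(1) _ sub]) (use assms(2) in auto)
  then show False using winding_number_circlepath[OF t] by simp
qed

text \<open>
  The enlarged compact set has to keep a connected complement. If \<open>\<Omega>\<close> is unbounded, the part of
  \<open>- \<Omega>\<close> in a large disc will do: its complement is the union of \<open>\<Omega>\<close> and the exterior of the disc,
  which overlap. If \<open>\<Omega>\<close> is bounded, that set would separate \<open>\<Omega>\<close> from infinity; instead a radial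
  segment disjoint from \<open>K\<close> and \<open>\<Omega>\<close> is added, and Janiszewski's theorem gives connectedness.
\<close>

lemma compacts_off_enlarge:
  fixes \<Omega> :: "complex set"
  assumes "open \<Omega>" "connected \<Omega>" "simply_connected \<Omega>" "\<Omega> \<noteq> UNIV" and K: "K \<in> compacts_off \<Omega>"
  obtains s where "0 \<le> s"
    "\<And>D. D \<ge> 0 \<Longrightarrow> \<exists>K'\<in>compacts_off \<Omega>. K \<subseteq> K' \<and> (\<forall>t\<in>{s..s + D}. \<exists>z\<in>K'. norm (z - a) = t)"
proof -
  have Kprops: "compact K" "K \<subseteq> - \<Omega>" "connected (- K)" using K by (auto simp: compacts_off_def)
  obtain M where M: "M > 0" "\<And>z. z \<in> K \<Longrightarrow> norm (z - a) \<le> M"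
  proof -
    obtain M where "M > 0" "K \<subseteq> cball a M"
      using bounded_subset_ballD[OF compact_imp_bounded[OF Kprops(1)]] ball_subset_cball order_trans by metis
    then show ?thesis using that by (auto simp: dist_norm norm_minus_commute subset_iff)
  qed
  show thesis
  proof (cases "bounded \<Omega>")
    case False
    obtain b where b: "b \<notin> \<Omega>" using assms(4) by blast
    define s where "s = max M (norm (b - a) + 1)"
    show thesis
    proof (rule that[of s])
      show "0 \<le> s" using M(1) by (simp add: s_def)
      fix D :: real assume "D \<ge> 0"
      define K' where "K' = - \<Omega> \<inter> cball a (s + D)"
      have "compact K'" unfolding K'_def using assms(1) by (intro closed_Int_compact) auto
      moreover have "connected (- K')"
      proof -
        have "connected (- cball a (s + D))"
          by (rule connected_complement_bounded_convex) auto
        moreover have "\<Omega> \<inter> - cball a (s + D) \<noteq> {}"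
          using False bounded_subset[OF bounded_cball] by blast
        ultimately have "connected (\<Omega> \<union> - cball a (s + D))"
          using connected_Un assms(2) by blast
        then show ?thesis by (simp add: K'_def Compl_Int)
      qed
      moreover have "K \<subseteq> K'"
        using Kprops(2) M(2) \<open>D \<ge> 0\<close> by (fastforce simp: K'_def s_def dist_norm norm_minus_commute)
      moreover have "\<exists>z\<in>K'. norm (z - a) = t" if t: "t \<in> {s..s + D}" for t
      proof -
        have "norm (b - a) < t" using t by (auto simp: s_def)
        from simply_connected_complement_meets_circle[OF assms(3) b this]
        show ?thesis using t by (auto simp: K'_def dist_norm norm_minus_commute)
      qed
      ultimately show "\<exists>K'\<in>compacts_off \<Omega>. K \<subseteq> K' \<and> (\<forall>t\<in>{s..s + D}. \<exists>z\<in>K'. norm (z - a) = t)"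
        by (intro bexI[of _ K']) (auto simp: compacts_off_def K'_def)
    qed
  next
    case True
    then obtain L where L: "L > 0" "\<Omega> \<subseteq> cball a L" using bounded_subset_ballD ball_subset_cball order_trans by metis
    define s where "s = max M L + 1"
    show thesis
    proof (rule that[of s])
      show "0 \<le> s" using M(1) by (simp add: s_def)
      fix D :: real assume "D \<ge> 0"
      define S where "S = (+) a ` of_real ` {s..s + D}"
      have S: "norm (z - a) \<ge> s" if "z \<in> S" for z
        using that \<open>0 \<le> s\<close> by (auto simp: S_def)
      have "compact S"
        unfolding S_def by (intro compact_translation compact_continuous_image continuous_intros) auto
      have "convex S"
        unfolding S_def
        by (intro convex_translation convex_linear_image bounded_linear.linear[OF bounded_linear_of_real])
          auto
      have disj: "K \<inter> S = {}" "\<Omega> \<inter> S = {}"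
        using S M(2) L(2) by (fastforce simp: s_def dist_norm norm_minus_commute)+
      have "connected (- (K \<union> S))"
      proof (rule Janiszewski_connected)
        show "connected (- S)"
          using \<open>compact S\<close> \<open>convex S\<close>
          by (intro connected_complement_bounded_convex compact_imp_bounded) auto
      qed (use Kprops disj \<open>compact S\<close> in \<open>auto intro: compact_imp_closed\<close>)
      then have "K \<union> S \<in> compacts_off \<Omega>"
        using Kprops disj \<open>compact S\<close> by (auto simp: compacts_off_def compact_Un)
      moreover have "\<exists>z\<in>K \<union> S. norm (z - a) = t" if t: "t \<in> {s..s + D}" for t
        using t \<open>0 \<le> s\<close> by (intro bexI[of _ "a + of_real t"]) (auto simp: S_def)
      ultimately show "\<exists>K'\<in>compacts_off \<Omega>. K \<subseteq> K' \<and> (\<forall>t\<in>{s..s + D}. \<exists>z\<in>K'. norm (z - a) = t)"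
        by blast
    qed
  qed
qed

section \<open>Change of centre\<close>

text \<open>
  The comparison behind the theorem. Let \<open>P\<close> be the partial sum of order \<open>N\<close> at \<open>\<zeta>\<^sub>0\<close>. Then
  the partial sum of order \<open>m\<close> at \<open>\<zeta>\<close> differs from \<open>P\<close> by two terms.
  \<^item> The Taylor sum at \<open>\<zeta>\<close> of \<open>f - P\<close>. Near \<open>\<zeta>\<close>, which is close to \<open>\<zeta>\<^sub>0\<close>, the difference
    \<open>f - P\<close> is of size \<open>(1 / 2) ^ N\<close>. Its Taylor sum of order \<open>m\<close> may grow geometrically in \<open>m\<close>
    far away from \<open>\<zeta>\<close>, but \<open>m \<le> N / c\<close> with \<open>c\<close> large keeps this growth below \<open>(3 / 2) ^ N\<close>.
  \<^item> The Taylor remainder of order \<open>m\<close> at \<open>\<zeta>\<close> of \<open>P\<close>. As \<open>P\<close> is bounded on a set that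
    meets many circles, it is at most \<open>A * (6 * exp 1) ^ N\<close> on a disc of radius \<open>D\<close>. Since \<open>N \<le> e * m\<close>,
    the factor \<open>(R / D) ^ m\<close> from the remainder wins once \<open>D\<close> is large compared with \<open>(6 * exp 1) ^ e\<close>.
    In classical terms, \<open>P\<close> has a Hadamard--Ostrowski gap between the orders \<open>m\<close> and \<open>N\<close>.
\<close>

lemma taylor_sum_change_center:
  assumes f: "f holomorphic_on cball \<zeta>\<^sub>0 r" and r: "r > 0" and close: "norm (\<zeta> - \<zeta>\<^sub>0) \<le> r / 4"
    and M: "\<And>z. norm (z - \<zeta>\<^sub>0) = r \<Longrightarrow> norm (f z) \<le> M"
    and R: "0 \<le> R" and w: "norm (w - \<zeta>) \<le> R"
    and c: "2 * max 1 (R / (r / 4)) \<le> (3 / 2) ^ c" and cm: "c * m \<le> N" and em: "N \<le> e * m"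
    and s: "0 \<le> s" "s \<le> D" and D: "0 < D" "2 * R \<le> D" "2 * (6 * exp 1) ^ e * R \<le> D"
    and circles: "\<And>t. s \<le> t \<Longrightarrow> t \<le> s + D \<Longrightarrow> \<exists>z\<in>K. norm (z - \<zeta>) = t"
    and A: "\<And>z. z \<in> K \<Longrightarrow> norm (taylor_sum \<zeta>\<^sub>0 N f z) \<le> A"
  shows "norm (taylor_sum \<zeta> m f w - taylor_sum \<zeta>\<^sub>0 N f w) \<le> M * (3 / 4) ^ N + 2 * A * (1 / 2) ^ m"
proof -
  define P where "P = taylor_sum \<zeta>\<^sub>0 N f"
  define \<kappa> where "\<kappa> = 6 * exp (1::real)"
  have "\<kappa> \<ge> 1" using exp_ge_add_one_self[of 1] unfolding \<kappa>_def by linarith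
  have "M \<ge> 0" by (rule circle_bound_nonneg[OF M r])
  obtain z\<^sub>0 where "z\<^sub>0 \<in> K" using circles[of s] D by auto
  with A have "A \<ge> 0" using norm_ge_zero order_trans by blast
  have fball: "f holomorphic_on ball \<zeta>\<^sub>0 r" using f by (rule holomorphic_on_subset) auto
  have Phol: "P holomorphic_on S" for S unfolding P_def by (rule holomorphic_on_taylor_sum)
  have near: "norm (z - \<zeta>\<^sub>0) \<le> r / 2" if "norm (z - \<zeta>) \<le> r / 4" for z
    using norm_triangle_ineq[of "z - \<zeta>" "\<zeta> - \<zeta>\<^sub>0"] that close by simp
  then have sub: "cball \<zeta> (r / 4) \<subseteq> ball \<zeta>\<^sub>0 r"
    using r by (force simp: dist_norm norm_minus_commute)
  have hhol: "(\<lambda>z. f z - P z) holomorphic_on cball \<zeta> (r / 4)"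
    by (intro holomorphic_intros holomorphic_on_subset[OF fball sub] Phol)
  have "norm (taylor_sum \<zeta> m (\<lambda>z. f z - P z) w) \<le> (M * (1 / 2) ^ N) * (2 * max 1 (R / (r / 4))) ^ m"
  proof (rule taylor_sum_bound[OF _ _ _ R _ w])
    show "(\<lambda>z. f z - P z) holomorphic_on ball \<zeta> (r / 4)"
      using hhol by (rule holomorphic_on_subset) auto
    show "continuous_on (cball \<zeta> (r / 4)) (\<lambda>z. f z - P z)"
      using hhol by (rule holomorphic_on_imp_continuous_on)
    show "norm (f z - P z) \<le> M * (1 / 2) ^ N" if "norm (z - \<zeta>) = r / 4" for z
      using taylor_remainder_bound[OF fball holomorphic_on_imp_continuous_on[OF f] _ _ r M, of "r / 2" z N]
        near[of z] that r by (simp add: P_def)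
  qed (use r in simp)
  also have "(2 * max 1 (R / (r / 4))) ^ m \<le> ((3 / 2) ^ c) ^ m"
    using c by (intro power_mono) auto
  also have "((3 / 2) ^ c) ^ m \<le> (3 / 2 :: real) ^ N"
    unfolding power_mult[symmetric] using cm by (intro power_increasing) auto
  also have "M * (1 / 2) ^ N * (3 / 2) ^ N = M * (3 / 4) ^ N"
    by (simp flip: power_mult_distrib)
  finally have tail: "norm (taylor_sum \<zeta> m (\<lambda>z. f z - P z) w) \<le> M * (3 / 4) ^ N"
    using \<open>M \<ge> 0\<close> by (simp add: mult_left_mono)
  have "norm (P w - taylor_sum \<zeta> m P w) \<le> 2 * (A * \<kappa> ^ N) * (R / D) ^ Suc m"
  proof (rule taylor_remainder_bound[OF Phol _ R D(2) D(1) _ w])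
    show "continuous_on (cball \<zeta> D) P" by (rule holomorphic_on_imp_continuous_on[OF Phol])
    obtain p where p: "degree p \<le> N" "\<And>z. poly p z = P z"
      unfolding P_def using taylor_sum_eq_poly[where N = N and \<zeta> = \<zeta>\<^sub>0 and f = f] by metis
    show "norm (P z) \<le> A * \<kappa> ^ N" if "norm (z - \<zeta>) = D" for z
      using poly_bound_from_circles[OF p(1) D(1) s circles, of A z] A that
      by (simp add: p(2) \<kappa>_def P_def)
  qed
  also have "\<dots> \<le> 2 * (A * (\<kappa> ^ e) ^ m) * (R / D) ^ m"
  proof (rule mult_mono)
    have "\<kappa> ^ N \<le> (\<kappa> ^ e) ^ m"
      unfolding power_mult[symmetric] using em \<open>\<kappa> \<ge> 1\<close> by (intro power_increasing) auto
    then show "2 * (A * \<kappa> ^ N) \<le> 2 * (A * (\<kappa> ^ e) ^ m)" using \<open>A \<ge> 0\<close> by (simp add: mult_left_mono)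
    show "(R / D) ^ Suc m \<le> (R / D) ^ m" using D R by (intro power_decreasing) auto
  qed (use \<open>A \<ge> 0\<close> \<open>\<kappa> \<ge> 1\<close> D R in auto)
  also have "\<dots> = 2 * A * (\<kappa> ^ e * R / D) ^ m"
    by (simp add: power_mult_distrib power_divide)
  also have "\<dots> \<le> 2 * A * (1 / 2) ^ m"
    using \<open>A \<ge> 0\<close> \<open>\<kappa> \<ge> 1\<close> D R
    by (intro mult_left_mono power_mono) (auto simp: field_simps \<kappa>_def)
  finally have head: "norm (P w - taylor_sum \<zeta> m P w) \<le> 2 * A * (1 / 2) ^ m" .
  have "taylor_sum \<zeta> m f w - P w = taylor_sum \<zeta> m (\<lambda>z. f z - P z) w - (P w - taylor_sum \<zeta> m P w)"
    using taylor_sum_diff[OF fball Phol open_ball, of \<zeta> m w] subsetD[OF sub, of \<zeta>] r by simp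
  then have "norm (taylor_sum \<zeta> m f w - P w) \<le>
      norm (taylor_sum \<zeta> m (\<lambda>z. f z - P z) w) + norm (P w - taylor_sum \<zeta> m P w)"
    by (simp only: norm_triangle_ineq4)
  then show ?thesis using tail head unfolding P_def by linarith
qed

text \<open>
  This is where the special form \<open>n ^ \<sigma>\<close> of the index sequences enters: replacing \<open>n\<close> by \<open>n div c\<close>
  divides all the orders \<open>n ^ \<sigma>\<close> simultaneously by factors between \<open>c\<close> and a constant, so that all
  of them fall into the respective gaps.
\<close>

lemma power_index_comparison:
  fixes n c \<sigma> :: nat
  assumes "1 \<le> c" "1 \<le> \<sigma>" "\<sigma> \<le> \<sigma>\<^sub>0" "1 \<le> n div c"
  shows "c * (n div c) ^ \<sigma> \<le> n ^ \<sigma>" "n ^ \<sigma> \<le> (2 * c) ^ \<sigma>\<^sub>0 * (n div c) ^ \<sigma>"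
proof -
  have "c * (n div c) ^ \<sigma> \<le> c ^ \<sigma> * (n div c) ^ \<sigma>"
    using assms power_increasing[of 1 \<sigma> c] by simp
  also have "\<dots> = (c * (n div c)) ^ \<sigma>" by (simp add: power_mult_distrib)
  also have "\<dots> \<le> n ^ \<sigma>" by (intro power_mono) auto
  finally show "c * (n div c) ^ \<sigma> \<le> n ^ \<sigma>" .
  have "n < c * (n div c) + c"
    using assms mod_less_divisor[of c n] mult_div_mod_eq[of c n] by linarith
  moreover have "c \<le> c * (n div c)" using assms by simp
  ultimately have "n \<le> 2 * c * (n div c)" by (simp only: mult.assoc)
  then have "n ^ \<sigma> \<le> (2 * c * (n div c)) ^ \<sigma>" by (intro power_mono) auto
  also have "\<dots> = (2 * c) ^ \<sigma> * (n div c) ^ \<sigma>" by (rule power_mult_distrib)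
  also have "\<dots> \<le> (2 * c) ^ \<sigma>\<^sub>0 * (n div c) ^ \<sigma>"
    using assms by (intro mult_right_mono power_increasing) auto
  finally show "n ^ \<sigma> \<le> (2 * c) ^ \<sigma>\<^sub>0 * (n div c) ^ \<sigma>" .
qed

text \<open>
  Given targets \<open>g \<sigma>\<close>, they are first replaced by partial sums \<open>p \<sigma>\<close> of \<open>f\<close> at \<open>\<zeta>\<^sub>0\<close>. These are
  polynomials, hence admissible targets also on the larger compact sets \<open>K' \<sigma>\<close>; the density of the
  polynomials in \<open>A(K \<sigma>)\<close> thus comes from the universality of \<open>f\<close> itself. Partial sums at \<open>\<zeta>\<^sub>0\<close> close to \<open>p \<sigma>\<close> on
  \<open>K' \<sigma>\<close> are bounded there, which is what allows the change of centre.
\<close>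

lemma U_mult_nearby_center:
  assumes \<Omega>: "open \<Omega>" "connected \<Omega>" "simply_connected \<Omega>" and \<sigma>\<^sub>0: "\<sigma>\<^sub>0 \<ge> 1"
    and r: "r > 0" "cball \<zeta>\<^sub>0 r \<subseteq> \<Omega>" and close: "norm (\<zeta> - \<zeta>\<^sub>0) \<le> r / 4"
    and f: "f \<in> U_mult \<Omega> \<zeta>\<^sub>0 \<sigma>\<^sub>0 (\<lambda>\<sigma> n. n ^ \<sigma>)"
  shows "f \<in> U_mult \<Omega> \<zeta> \<sigma>\<^sub>0 (\<lambda>\<sigma> n. n ^ \<sigma>)"
  unfolding U_mult_iff
proof (intro conjI allI impI)
  let ?I = "{1..\<sigma>\<^sub>0}"
  show fhol: "f holomorphic_on \<Omega>" using f by (simp add: U_mult_iff)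
  fix K g and \<epsilon> :: real
  assume K: "K \<in> ?I \<rightarrow> compacts_off \<Omega>"
    and g: "\<forall>\<sigma>\<in>?I. continuous_on (K \<sigma>) (g \<sigma>) \<and> g \<sigma> holomorphic_on interior (K \<sigma>)"
    and \<epsilon>: "\<epsilon> > 0"
  show "\<exists>n\<ge>1. \<forall>\<sigma>\<in>?I. \<forall>z\<in>K \<sigma>. norm (taylor_sum \<zeta> (n ^ \<sigma>) f z - g \<sigma> z) < \<epsilon>"
  proof (cases "\<Omega> = UNIV")
    \<comment> \<open>For the whole plane the empty set is the only admissible compact set.\<close>
    case True
    then have "K \<sigma> = {}" if "\<sigma> \<in> ?I" for \<sigma> using K that by (auto simp: compacts_off_def)
    then show ?thesis by auto
  next
    case False
    have "\<epsilon> / 2 > 0" using \<epsilon> by simp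
    from U_mult_approx[OF f K _ this, of g] have "\<exists>k\<ge>1. \<forall>\<sigma>\<in>?I. \<forall>z\<in>K \<sigma>. norm (taylor_sum \<zeta>\<^sub>0 (k ^ \<sigma>) f z - g \<sigma> z) < \<epsilon> / 2"
      using g by blast
    then obtain k where k: "\<forall>\<sigma>\<in>?I. \<forall>z\<in>K \<sigma>. norm (taylor_sum \<zeta>\<^sub>0 (k ^ \<sigma>) f z - g \<sigma> z) < \<epsilon> / 2"
      by blast
    define p where "p \<sigma> = taylor_sum \<zeta>\<^sub>0 (k ^ \<sigma>) f" for \<sigma> :: nat
    have "bounded (\<Union>\<sigma>\<in>?I. K \<sigma>)"
      using K by (intro bounded_UN) (fastforce simp: compacts_off_def intro: compact_imp_bounded)+
    then obtain R where "R > 0" "(\<Union>\<sigma>\<in>?I. K \<sigma>) \<subseteq> ball \<zeta> R"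
      using bounded_subset_ballD by blast
    then have R: "R \<ge> 0" "\<And>\<sigma> z. \<sigma> \<in> ?I \<Longrightarrow> z \<in> K \<sigma> \<Longrightarrow> norm (z - \<zeta>) \<le> R"
      by (force simp: dist_norm norm_minus_commute)+
    obtain c\<^sub>0 :: nat where c\<^sub>0: "2 * max 1 (R / (r / 4)) < (3 / 2 :: real) ^ c\<^sub>0"
      using real_arch_pow[of "3/2"] by auto
    \<comment> \<open>The divisor \<open>c\<close> must be positive, hence the successor.\<close>
    define c where "c = Suc c\<^sub>0"
    have c: "c \<ge> 1" "2 * max 1 (R / (r / 4)) \<le> (3 / 2) ^ c"
      using c\<^sub>0 power_increasing[of c\<^sub>0 "Suc c\<^sub>0" "3/2::real"] by (auto simp: c_def)
    define e where "e = (2 * c) ^ \<sigma>\<^sub>0"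
    have "\<exists>s\<ge>0. \<forall>D\<ge>0. \<exists>K'\<in>compacts_off \<Omega>. K \<sigma> \<subseteq> K' \<and> (\<forall>t\<in>{s..s + D}. \<exists>z\<in>K'. norm (z - \<zeta>) = t)"
      if "\<sigma> \<in> ?I" for \<sigma>
    proof -
      have "K \<sigma> \<in> compacts_off \<Omega>" using K that by blast
      from compacts_off_enlarge[OF \<Omega> False this, of \<zeta>] show ?thesis by metis
    qed
    then obtain s where s: "\<And>\<sigma>. \<sigma> \<in> ?I \<Longrightarrow> s \<sigma> \<ge> 0"
      "\<And>\<sigma> D. \<sigma> \<in> ?I \<Longrightarrow> D \<ge> 0 \<Longrightarrow> \<exists>K'\<in>compacts_off \<Omega>. K \<sigma> \<subseteq> K' \<and>
         (\<forall>t\<in>{s \<sigma>..s \<sigma> + D}. \<exists>z\<in>K'. norm (z - \<zeta>) = t)"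
      by metis
    define D where "D = Max (insert (1 + 2 * R + 2 * (6 * exp 1) ^ e * R) (s ` ?I))"
    have Dge: "1 + 2 * R + 2 * (6 * exp 1) ^ e * R \<le> D" unfolding D_def by (rule Max_ge) auto
    have sD: "s \<sigma> \<le> D" if "\<sigma> \<in> ?I" for \<sigma> unfolding D_def using that by (intro Max_ge) auto
    have "0 \<le> 2 * (6 * exp 1) ^ e * R" using R by simp
    with Dge R(1) have D: "0 < D" "2 * R \<le> D" "2 * (6 * exp 1) ^ e * R \<le> D" by linarith+
    obtain K' where K': "\<And>\<sigma>. \<sigma> \<in> ?I \<Longrightarrow> K' \<sigma> \<in> compacts_off \<Omega>" "\<And>\<sigma>. \<sigma> \<in> ?I \<Longrightarrow> K \<sigma> \<subseteq> K' \<sigma>"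
      "\<And>\<sigma> t. \<sigma> \<in> ?I \<Longrightarrow> s \<sigma> \<le> t \<Longrightarrow> t \<le> s \<sigma> + D \<Longrightarrow> \<exists>z\<in>K' \<sigma>. norm (z - \<zeta>) = t"
      using s(2)[of _ D] D(1) by (metis atLeastAtMost_iff less_imp_le)
    have "bounded (\<Union>\<sigma>\<in>?I. p \<sigma> ` K' \<sigma>)"
    proof (intro bounded_UN ballI compact_imp_bounded compact_continuous_image)
      fix \<sigma> assume "\<sigma> \<in> ?I"
      then show "compact (K' \<sigma>)" using K'(1) by (auto simp: compacts_off_def)
      show "continuous_on (K' \<sigma>) (p \<sigma>)"
        unfolding p_def by (intro holomorphic_on_imp_continuous_on holomorphic_on_taylor_sum)
    qed simp
    then obtain A where A: "\<And>\<sigma> z. \<sigma> \<in> ?I \<Longrightarrow> z \<in> K' \<sigma> \<Longrightarrow> norm (p \<sigma> z) \<le> A"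
      unfolding bounded_iff by blast
    have fr: "f holomorphic_on cball \<zeta>\<^sub>0 r" using fhol r(2) by (rule holomorphic_on_subset)
    have "bounded (f ` cball \<zeta>\<^sub>0 r)"
      by (intro compact_imp_bounded compact_continuous_image holomorphic_on_imp_continuous_on fr) auto
    then obtain M where "\<forall>z\<in>cball \<zeta>\<^sub>0 r. norm (f z) \<le> M" unfolding bounded_iff by blast
    then have M: "norm (f z) \<le> M" if "norm (z - \<zeta>\<^sub>0) = r" for z
      using that by (simp add: dist_norm norm_minus_commute)
    have one: "1 \<in> ?I" using \<sigma>\<^sub>0 by simp
    obtain z\<^sub>0 where z\<^sub>0: "z\<^sub>0 \<in> K' 1" using K'(3)[OF one, of "s 1"] D(1) by auto
    have "M \<ge> 0" by (rule circle_bound_nonneg[OF M r(1)])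
    have "A \<ge> 0" using A[OF one z\<^sub>0] norm_ge_zero order_trans by blast
    define C where "C = M + 2 * (A + 1)"
    have "C > 0" using \<open>M \<ge> 0\<close> \<open>A \<ge> 0\<close> by (simp add: C_def)
    obtain j where j: "(3 / 4 :: real) ^ j < \<epsilon> / 4 / C"
      using real_arch_pow_inv[of "\<epsilon> / 4 / C" "3/4"] \<epsilon> \<open>C > 0\<close> by auto
    have K'Pi: "K' \<in> ?I \<rightarrow> compacts_off \<Omega>" using K'(1) by blast
    have pK': "continuous_on (K' \<sigma>) (p \<sigma>) \<and> p \<sigma> holomorphic_on interior (K' \<sigma>)" for \<sigma>
      unfolding p_def by (intro conjI holomorphic_on_imp_continuous_on holomorphic_on_taylor_sum)
    \<comment> \<open>The accuracy \<open>\<epsilon> / 4\<close> is for the approximation; accuracy 1 gives the bound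
      \<open>A + 1\<close> on \<open>K' \<sigma>\<close>, uniformly in \<open>n\<close>.\<close>
    have "min 1 (\<epsilon> / 4) > 0" using \<epsilon> by simp
    then obtain n where n: "n \<ge> c * Suc j" "\<And>\<sigma> z. \<sigma> \<in> ?I \<Longrightarrow> z \<in> K' \<sigma> \<Longrightarrow>
        norm (taylor_sum \<zeta>\<^sub>0 (n ^ \<sigma>) f z - p \<sigma> z) < min 1 (\<epsilon> / 4)"
      using U_mult_infinitely_often[OF f K'Pi pK' _ one z\<^sub>0] by blast
    define n' where "n' = n div c"
    have n': "n' \<ge> Suc j"
      using div_le_mono[OF n(1), of c] c(1) by (simp add: n'_def)
    have "norm (taylor_sum \<zeta> (n' ^ \<sigma>) f z - g \<sigma> z) < \<epsilon>" if \<sigma>: "\<sigma> \<in> ?I" and z: "z \<in> K \<sigma>" for \<sigma> z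
    proof -
      have zK': "z \<in> K' \<sigma>" using K'(2) \<sigma> z by blast
      have TA: "norm (taylor_sum \<zeta>\<^sub>0 (n ^ \<sigma>) f y) \<le> A + 1" if "y \<in> K' \<sigma>" for y
        using n(2)[OF \<sigma> that] A[OF \<sigma> that] norm_triangle_sub[of "taylor_sum \<zeta>\<^sub>0 (n ^ \<sigma>) f y" "p \<sigma> y"]
        by simp
      have idx: "c * n' ^ \<sigma> \<le> n ^ \<sigma>" "n ^ \<sigma> \<le> e * n' ^ \<sigma>"
        using power_index_comparison[of c \<sigma> \<sigma>\<^sub>0 n] c(1) \<sigma> n' unfolding n'_def e_def by auto
      have "norm (taylor_sum \<zeta> (n' ^ \<sigma>) f z - taylor_sum \<zeta>\<^sub>0 (n ^ \<sigma>) f z)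
          \<le> M * (3 / 4) ^ (n ^ \<sigma>) + 2 * (A + 1) * (1 / 2) ^ (n' ^ \<sigma>)"
        by (rule taylor_sum_change_center[OF fr r(1) close M R(1) R(2)[OF \<sigma> z] c(2) idx s(1)[OF \<sigma>] sD[OF \<sigma>]
              D K'(3)[OF \<sigma>] TA])
      also have "\<dots> \<le> M * (3 / 4) ^ j + 2 * (A + 1) * (3 / 4) ^ j"
      proof (intro add_mono mult_left_mono)
        have "j \<le> n'" using n' by simp
        also have nle: "n' \<le> n' ^ \<sigma>" using \<sigma> n' self_le_power[of n' \<sigma>] by simp
        finally have jle: "j \<le> n' ^ \<sigma>" .
        also have "n' ^ \<sigma> \<le> n ^ \<sigma>" unfolding n'_def by (intro power_mono) auto
        finally show "(3 / 4 :: real) ^ (n ^ \<sigma>) \<le> (3 / 4) ^ j" by (intro power_decreasing) auto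
        have "(1 / 2 :: real) ^ (n' ^ \<sigma>) \<le> (3 / 4) ^ (n' ^ \<sigma>)" by (intro power_mono) auto
        also have "\<dots> \<le> (3 / 4) ^ j" using jle by (intro power_decreasing) auto
        finally show "(1 / 2 :: real) ^ (n' ^ \<sigma>) \<le> (3 / 4) ^ j" .
      qed (use \<open>M \<ge> 0\<close> \<open>A \<ge> 0\<close> in auto)
      also have "\<dots> = C * (3 / 4) ^ j" by (simp add: C_def distrib_right)
      also have "\<dots> < \<epsilon> / 4" using j \<open>C > 0\<close> by (simp add: field_simps)
      finally have 1: "norm (taylor_sum \<zeta> (n' ^ \<sigma>) f z - taylor_sum \<zeta>\<^sub>0 (n ^ \<sigma>) f z) < \<epsilon> / 4" .
      have 2: "norm (taylor_sum \<zeta>\<^sub>0 (n ^ \<sigma>) f z - p \<sigma> z) < \<epsilon> / 4" using n(2)[OF \<sigma> zK'] by simp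
      have 3: "norm (p \<sigma> z - g \<sigma> z) < \<epsilon> / 2" using k \<sigma> z unfolding p_def by blast
      show ?thesis
        using norm_diff_triangle_less[OF norm_diff_triangle_less[OF 1 2] 3] by simp
    qed
    then show ?thesis using n' by (intro exI[of _ n']) auto
  qed
qed

theorem theorem3p1:
  fixes \<Omega> :: "complex set" and \<sigma>\<^sub>0 :: nat and \<zeta>\<^sub>0 \<zeta> :: complex
  assumes "open \<Omega>" and "connected \<Omega>" and "simply_connected \<Omega>"
    and "\<sigma>\<^sub>0 \<ge> 1" and "\<zeta>\<^sub>0 \<in> \<Omega>" and "\<zeta> \<in> \<Omega>"
  shows "U_mult \<Omega> \<zeta>\<^sub>0 \<sigma>\<^sub>0 (\<lambda>\<sigma> n. n ^ \<sigma>) = U_mult \<Omega> \<zeta> \<sigma>\<^sub>0 (\<lambda>\<sigma> n. n ^ \<sigma>)"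
proof -
  define U where "U a = U_mult \<Omega> a \<sigma>\<^sub>0 (\<lambda>\<sigma> n. n ^ \<sigma>)" for a
  have "U constant_on \<Omega>"
  proof (rule locally_constant_imp_constant[OF assms(2)])
    fix a assume "a \<in> \<Omega>"
    then obtain r where r: "r > 0" "cball a r \<subseteq> \<Omega>"
      using assms(1) open_contains_cball by blast
    \<comment> \<open>The radius \<open>r / 8\<close> allows the step in both directions: from \<open>a\<close> with the disc of radius
      \<open>r\<close>, and back from \<open>x\<close> with the smaller disc of radius \<open>r / 2\<close>.\<close>
    have "U x = U a" if x: "x \<in> ball a (r / 8)" for x
    proof (rule antisym; rule subsetI)
      have xa: "norm (x - a) \<le> r / 8" "norm (a - x) \<le> r / 8"
        using x by (simp_all add: dist_norm norm_minus_commute)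
      show "f \<in> U x" if "f \<in> U a" for f
      proof -
        have "norm (x - a) \<le> r / 4" using xa r(1) by linarith
        from U_mult_nearby_center[OF assms(1-4) r this that[unfolded U_def]]
        show ?thesis by (simp only: U_def)
      qed
      show "f \<in> U a" if "f \<in> U x" for f
      proof -
        have "cball x (r / 2) \<subseteq> cball a r"
          using xa(1) r(1) by (simp add: cball_subset_cball_iff dist_norm)
        then have "cball x (r / 2) \<subseteq> \<Omega>" using r(2) by (rule order_trans)
        moreover have "r / 2 > 0" "norm (a - x) \<le> r / 2 / 4" using xa(2) r(1) by simp_all
        ultimately show ?thesis
          using U_mult_nearby_center[OF assms(1-4) _ _ _ that[unfolded U_def]] by (simp only: U_def)
      qed
    qed
    moreover have "ball a (r / 8) \<subseteq> \<Omega>"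
      using r by (intro order_trans[OF _ r(2)]) auto
    then have "openin (top_of_set \<Omega>) (ball a (r / 8))" by (simp add: open_subset)
    moreover have "a \<in> ball a (r / 8)" using r(1) by simp
    ultimately show "\<exists>T. openin (top_of_set \<Omega>) T \<and> a \<in> T \<and> (\<forall>x\<in>T. U x = U a)"
      by blast
  qed
  then obtain V where "\<And>a. a \<in> \<Omega> \<Longrightarrow> U a = V" unfolding constant_on_def by blast
  then have "U \<zeta>\<^sub>0 = U \<zeta>" using assms(5,6) by simp
  then show ?thesis by (simp only: U_def)
qed

end
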